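(* Let $G$ be a group, let $n\ge 0$, let $\rho:G\to\Sigma_n$ be a group homomorphism, and let $c:G\times G\to(\mathbb{C}^\times)^n_\rho$ be a 2-cocycle, with components $c_i$, $1\le i\le n$. Then the 2-character of the 2-representation of $G$ in $2Vect_{\mathbb{C}}$ given by $\rho$ and $c$ is, for every pair $g,h\in G$ with $gh=hg$, $$\chi(g,h)=\sum_{\substack{1\le i\le n\\ i=\rho_g(i)=\rho_h(i)}} c_i(g,g^{-1})^{-1}\,c_i(1,1)^{-1}\,c_i(h,g^{-1})\,c_i(g,hg^{-1}).$$
   Context: **2-vector spaces.** For a field $k$, the 2-category $2Vect_k$ has objects $[n]$, $n\in\{0,1,2,\dots\}$; 1-morphisms are 2-matrices, i.e. matrices whose entries are $k$-vector spaces (an endomorphism of $[n]$ is an $n\times n$ 2-matrix), composed by matrix multiplication using $\oplus$ and $\otimes$ (with the usual canonical isomorphisms treated as identities); 2-morphisms $A\Rightarrow B$ between 2-matrices of the same size are matrices of linear maps $A_{ij}\to B_{ij}$. The identity $\mathbf 1_{[n]}$ has $k$ on the diagonal and $0$ elsewhere. Write $\cdot$ or juxtaposition for the (entrywise) composition of 2-morphisms and $\circ$ for composition of 1-morphisms and whiskering. **2-representations.** A 2-representation of $G$ in $2Vect_k$ consists of an object $[n]$ ($n$ is the dimension), 1-morphisms $\rho_g:[n]\to[n]$ for $g\in G$, a 2-isomorphism $\phi_1:\rho_1\Rightarrow\mathbf 1_{[n]}$, and 2-isomorphisms $\phi_{g,h}:\rho_g\circ\rho_h\Rightarrow\rho_{gh}$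 for $g,h\in G$, such that $\phi_{gh,l}(\phi_{g,h}\circ\rho_l)=\phi_{g,hl}(\rho_g\circ\phi_{h,l})$ for all $g,h,l\in G$, and $\phi_{1,g}=\phi_1\circ\rho_g$, $\phi_{g,1}=\rho_g\circ\phi_1$ for all $g\in G$. **The 2-representation given by $\rho$ and $c$.** For a homomorphism $\rho:G\to\Sigma_n$, $(\mathbb{C}^\times)^n_\rho$ is the $G$-module $(\mathbb{C}^\times)^n$ with $(g\cdot a)_i=a_{\rho_g^{-1}(i)}$. A 2-cocycle $c:G\times G\to(\mathbb{C}^\times)^n_\rho$ satisfies, in components, $c_{\rho_g^{-1}(i)}(h,l)\,c_i(g,hl)=c_i(gh,l)\,c_i(g,h)$ for all $g,h,l\in G$ and all $i$ (not assumed normalized). The associated 2-representation on $[n]$ has $\rho_g$ the permutation 2-matrix with entry $\mathbb{C}$ in position $(\rho_g(j),j)$ for each $j$ and $0$ elsewhere; $\phi_{g,h}$ is multiplication by $c_i(g,h)$ on the unique nonzero entry of row $i$; and $\phi_1$ is multiplication by $c_i(1,1)$ on row $i$. **2-character.** The categorical trace of a 1-endomorphism $F:[n]\to[n]$ is the vector space $\mathbb{T}r(F)=2Hom(\mathbf 1_{[n]},F)$ $(=\bigoplus_i F_{ii})$. For $g,h\in G$ the linear map $\psi_g(h):\mathbb{T}r(\rho_h)\to\mathbb{T}r(\rho_{ghg^{-1}})$ sends $\varphi:\mathbf 1_{[n]}\Rightarrow\rho_h$ to $$\phi_{g,h,g^{-1}}\cdot(\rho_g\circ\varphi\circ\rho_{g^{-1}})\cdot\phi_{g,g^{-1}}^{-1}\cdot\phi_1^{-1},\qquad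 \phi_{g,h,g^{-1}}=\phi_{g,hg^{-1}}(\rho_g\circ\phi_{h,g^{-1}}):\rho_g\circ\rho_h\circ\rho_{g^{-1}}\Rightarrow\rho_{ghg^{-1}}.$$ If $gh=hg$, this is an endomorphism of $\mathbb{T}r(\rho_h)$, and the 2-character is $\chi(g,h)=\operatorname{trace}\bigl(\psi_g(h):\mathbb{T}r(\rho_h)\to\mathbb{T}r(\rho_h)\bigr)$. *)

theory Defs
  imports Complex_Main "HOL-Algebra.Sym_Groups" "HOL-Library.Function_Algebras"
begin

section \<open>Vector spaces and traces\<close>

text \<open>
  Vector spaces over a field are represented by linear subspaces of function spaces
  \<open>'x \<Rightarrow> 'k\<close>; every vector space is isomorphic to one of this form.
\<close>

definition vscale :: "'k::field \<Rightarrow> ('x \<Rightarrow> 'k) \<Rightarrow> 'x \<Rightarrow> 'k" where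
  "vscale a v = (\<lambda>x. a * v x)"

interpretation fs: vector_space "vscale :: 'k::field \<Rightarrow> ('x \<Rightarrow> 'k) \<Rightarrow> 'x \<Rightarrow> 'k"
  by unfold_locales (auto simp: vscale_def fun_eq_iff algebra_simps)

text \<open>The trace does not depend on the chosen basis; see \<open>trace_on_eq\<close> below.\<close>

definition (in vector_space) trace_on :: "'b set \<Rightarrow> ('b \<Rightarrow> 'b) \<Rightarrow> 'a" where
  "trace_on V f =
     (let B = (SOME B. independent B \<and> span B = V) in \<Sum>b\<in>B. representation B (f b) b)"

text \<open>
  A linear map defined on a subspace is extended by \<open>0\<close> outside of it, so that equality of
  linear maps is equality of functions and the linear maps form a subspace.
\<close>

definition lin_maps ::
    "('x \<Rightarrow> 'k::field) set \<Rightarrow> ('y \<Rightarrow> 'k) set \<Rightarrow> (('x \<Rightarrow> 'k) \<Rightarrow> ('y \<Rightarrow> 'k)) set" where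
  "lin_maps V W = {f. (\<forall>v\<in>V. f v \<in> W)
     \<and> (\<forall>u\<in>V. \<forall>v\<in>V. f (u + v) = f u + f v)
     \<and> (\<forall>a. \<forall>v\<in>V. f (vscale a v) = vscale a (f v))
     \<and> (\<forall>v. v \<notin> V \<longrightarrow> f v = 0)}"

definition pure_tensor :: "('x \<Rightarrow> 'k::field) \<Rightarrow> ('y \<Rightarrow> 'k) \<Rightarrow> 'x \<times> 'y \<Rightarrow> 'k" where
  "pure_tensor v w = (\<lambda>(x, y). v x * w y)"

definition tensor :: "('x \<Rightarrow> 'k::field) set \<Rightarrow> ('y \<Rightarrow> 'k) set \<Rightarrow> ('x \<times> 'y \<Rightarrow> 'k) set" where
  "tensor V W = fs.span {pure_tensor v w | v w. v \<in> V \<and> w \<in> W}"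

text \<open>
  The tensor product of linear maps: first \<open>f\<close> is applied in the variable \<open>x\<close>, then \<open>g\<close> in the
  variable \<open>y\<close>. On \<open>tensor V W\<close> this is the linear map with \<open>v \<otimes> w \<mapsto> f v \<otimes> g w\<close>; see
  \<open>tensor_map_pure\<close> and \<open>tensor_map_linear\<close> below.
\<close>

definition tensor_map ::
    "(('x \<Rightarrow> 'k::field) \<Rightarrow> 'x' \<Rightarrow> 'k) \<Rightarrow> (('y \<Rightarrow> 'k) \<Rightarrow> 'y' \<Rightarrow> 'k) \<Rightarrow> ('x \<times> 'y \<Rightarrow> 'k) \<Rightarrow> 'x' \<times> 'y' \<Rightarrow> 'k"
  where "tensor_map f g t = (\<lambda>(x', y'). g (\<lambda>y. f (\<lambda>x. t (x, y)) x') y')"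

definition dsum :: "nat \<Rightarrow> (nat \<Rightarrow> ('x \<Rightarrow> 'k::field) set) \<Rightarrow> (nat \<times> 'x \<Rightarrow> 'k) set" where
  "dsum n U = {s. (\<forall>j\<in>{1..n}. (\<lambda>x. s (j, x)) \<in> U j) \<and> (\<forall>j. j \<notin> {1..n} \<longrightarrow> (\<forall>x. s (j, x) = 0))}"


section \<open>Endomorphisms of an object of the 2-category of 2-vector spaces\<close>

text \<open>
  1-endomorphisms of \<open>[n]\<close> and 2-morphisms between them; rows and columns are indexed by
  \<open>{1..n}\<close>. Entries of a 2-matrix outside this range are irrelevant, those of a 2-morphism are \<open>0\<close>.
\<close>

type_synonym ('x, 'k) mat2 = "nat \<Rightarrow> nat \<Rightarrow> ('x \<Rightarrow> 'k) set"

type_synonym ('x, 'y, 'k) mor2 = "nat \<Rightarrow> nat \<Rightarrow> ('x \<Rightarrow> 'k) \<Rightarrow> ('y \<Rightarrow> 'k)"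

definition is_mat2 :: "nat \<Rightarrow> ('x, 'k::field) mat2 \<Rightarrow> bool" where
  "is_mat2 n A \<longleftrightarrow> (\<forall>i\<in>{1..n}. \<forall>j\<in>{1..n}. fs.subspace (A i j))"

definition hom2 :: "nat \<Rightarrow> ('x, 'k::field) mat2 \<Rightarrow> ('y, 'k) mat2 \<Rightarrow> ('x, 'y, 'k) mor2 set" where
  "hom2 n A B = {\<eta>. \<forall>i j. if i \<in> {1..n} \<and> j \<in> {1..n} then \<eta> i j \<in> lin_maps (A i j) (B i j) else \<eta> i j = 0}"

definition restrict2 :: "nat \<Rightarrow> ('x, 'k::field) mat2 \<Rightarrow> ('x, 'y, 'k) mor2 \<Rightarrow> ('x, 'y, 'k) mor2" where
  "restrict2 n A \<eta> = (\<lambda>i j v. if i \<in> {1..n} \<and> j \<in> {1..n} \<and> v \<in> A i j then \<eta> i j v else 0)"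

definition id2 :: "nat \<Rightarrow> ('x, 'k::field) mat2 \<Rightarrow> ('x, 'x, 'k) mor2" where
  "id2 n A = restrict2 n A (\<lambda>i j v. v)"

definition vcomp :: "('y, 'z, 'k::field) mor2 \<Rightarrow> ('x, 'y, 'k) mor2 \<Rightarrow> ('x, 'z, 'k) mor2"
    (infixr "\<cdot>\<^sub>2" 60) where
  "\<eta> \<cdot>\<^sub>2 \<theta> = (\<lambda>i j v. \<eta> i j (\<theta> i j v))"

definition inverse2_of ::
    "nat \<Rightarrow> ('x, 'k::field) mat2 \<Rightarrow> ('y, 'k) mat2 \<Rightarrow> ('x, 'y, 'k) mor2 \<Rightarrow> ('y, 'x, 'k) mor2 \<Rightarrow> bool" where
  "inverse2_of n A B \<eta> \<theta> \<longleftrightarrow> \<theta> \<in> hom2 n B A \<and> \<theta> \<cdot>\<^sub>2 \<eta> = id2 n A \<and> \<eta> \<cdot>\<^sub>2 \<theta> = id2 n B"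

definition iso2 :: "nat \<Rightarrow> ('x, 'k::field) mat2 \<Rightarrow> ('y, 'k) mat2 \<Rightarrow> ('x, 'y, 'k) mor2 set" where
  "iso2 n A B = {\<eta> \<in> hom2 n A B. \<exists>\<theta>. inverse2_of n A B \<eta> \<theta>}"

definition inv2 ::
    "nat \<Rightarrow> ('x, 'k::field) mat2 \<Rightarrow> ('y, 'k) mat2 \<Rightarrow> ('x, 'y, 'k) mor2 \<Rightarrow> ('y, 'x, 'k) mor2" where
  "inv2 n A B \<eta> = (THE \<theta>. inverse2_of n A B \<eta> \<theta>)"

definition one2 :: "(unit, 'k::field) mat2" where
  "one2 = (\<lambda>i j. if i = j then UNIV else {0})"

definition comp1 ::
    "nat \<Rightarrow> ('x, 'k::field) mat2 \<Rightarrow> ('y, 'k) mat2 \<Rightarrow> (nat \<times> 'x \<times> 'y, 'k) mat2" where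
  "comp1 n A B = (\<lambda>i k. dsum n (\<lambda>j. tensor (A i j) (B j k)))"

text \<open>Horizontal composition of \<open>\<eta>\<close> with domain \<open>A\<close> and \<open>\<theta>\<close> with domain \<open>B\<close>.\<close>

definition hcomp ::
    "nat \<Rightarrow> ('x, 'k::field) mat2 \<Rightarrow> ('y, 'k) mat2 \<Rightarrow> ('x, 'x', 'k) mor2 \<Rightarrow> ('y, 'y', 'k) mor2
      \<Rightarrow> (nat \<times> 'x \<times> 'y, nat \<times> 'x' \<times> 'y', 'k) mor2" where
  "hcomp n A B \<eta> \<theta> = restrict2 n (comp1 n A B)
     (\<lambda>i k s. \<lambda>(j, z). tensor_map (\<eta> i j) (\<theta> j k) (\<lambda>w. s (j, w)) z)"

definition lwhisker ::
    "nat \<Rightarrow> ('x, 'k::field) mat2 \<Rightarrow> ('y, 'k) mat2 \<Rightarrow> ('y, 'z, 'k) mor2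
      \<Rightarrow> (nat \<times> 'x \<times> 'y, nat \<times> 'x \<times> 'z, 'k) mor2" where
  "lwhisker n A B \<theta> = hcomp n A B (id2 n A) \<theta>"

definition rwhisker ::
    "nat \<Rightarrow> ('x, 'k::field) mat2 \<Rightarrow> ('y, 'k) mat2 \<Rightarrow> ('x, 'z, 'k) mor2
      \<Rightarrow> (nat \<times> 'x \<times> 'y, nat \<times> 'z \<times> 'y, 'k) mor2" where
  "rwhisker n A B \<eta> = hcomp n A B \<eta> (id2 n B)"

text \<open>
  The canonical isomorphisms \<open>(A \<circ> B) \<circ> C \<Rightarrow> A \<circ> (B \<circ> C)\<close>, \<open>\<one> \<circ> A \<Rightarrow> A\<close> and \<open>A \<circ> \<one> \<Rightarrow> A\<close>, which are
  usually suppressed.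
\<close>

definition assoc2 ::
    "nat \<Rightarrow> ('x, 'k::field) mat2 \<Rightarrow> ('y, 'k) mat2 \<Rightarrow> ('z, 'k) mat2
      \<Rightarrow> (nat \<times> (nat \<times> 'x \<times> 'y) \<times> 'z, nat \<times> 'x \<times> (nat \<times> 'y \<times> 'z), 'k) mor2" where
  "assoc2 n A B C = restrict2 n (comp1 n (comp1 n A B) C)
     (\<lambda>i l s. \<lambda>(j, x, (k, y, z)). s (k, (j, x, y), z))"

definition lunit2 :: "nat \<Rightarrow> ('x, 'k::field) mat2 \<Rightarrow> (nat \<times> unit \<times> 'x, 'x, 'k) mor2" where
  "lunit2 n A = restrict2 n (comp1 n one2 A) (\<lambda>i j s. \<lambda>x. s (i, (), x))"

definition runit2 :: "nat \<Rightarrow> ('x, 'k::field) mat2 \<Rightarrow> (nat \<times> 'x \<times> unit, 'x, 'k) mor2" where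
  "runit2 n A = restrict2 n (comp1 n A one2) (\<lambda>i j s. \<lambda>x. s (j, x, ()))"


section \<open>2-representations and 2-characters\<close>

record ('g, 'x, 'k) two_rep =
  rdim :: nat
  rmor :: "'g \<Rightarrow> ('x, 'k) mat2"
  runit :: "('x, unit, 'k) mor2"
  rmult :: "'g \<Rightarrow> 'g \<Rightarrow> (nat \<times> 'x \<times> 'x, 'x, 'k) mor2"

definition two_representation ::
    "('g, 'm) monoid_scheme \<Rightarrow> ('g, 'x, 'k::field) two_rep \<Rightarrow> bool" where
  "two_representation G R \<longleftrightarrow>
    (let n = rdim R; r = rmor R; \<phi>1 = runit R; \<phi> = rmult R in
      (\<forall>g\<in>carrier G. is_mat2 n (r g))
    \<and> \<phi>1 \<in> iso2 n (r \<one>\<^bsub>G\<^esub>) one2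
    \<and> (\<forall>g\<in>carrier G. \<forall>h\<in>carrier G. \<phi> g h \<in> iso2 n (comp1 n (r g) (r h)) (r (g \<otimes>\<^bsub>G\<^esub> h)))
    \<and> (\<forall>g\<in>carrier G. \<forall>h\<in>carrier G. \<forall>l\<in>carrier G.
         \<phi> (g \<otimes>\<^bsub>G\<^esub> h) l \<cdot>\<^sub>2 rwhisker n (comp1 n (r g) (r h)) (r l) (\<phi> g h)
         = \<phi> g (h \<otimes>\<^bsub>G\<^esub> l) \<cdot>\<^sub>2 lwhisker n (r g) (comp1 n (r h) (r l)) (\<phi> h l)
             \<cdot>\<^sub>2 assoc2 n (r g) (r h) (r l))
    \<and> (\<forall>g\<in>carrier G. \<phi> \<one>\<^bsub>G\<^esub> g = lunit2 n (r g) \<cdot>\<^sub>2 rwhisker n (r \<one>\<^bsub>G\<^esub>) (r g) \<phi>1)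
    \<and> (\<forall>g\<in>carrier G. \<phi> g \<one>\<^bsub>G\<^esub> = runit2 n (r g) \<cdot>\<^sub>2 lwhisker n (r g) (r \<one>\<^bsub>G\<^esub>) \<phi>1))"

definition cat_trace :: "nat \<Rightarrow> ('x, 'k::field) mat2 \<Rightarrow> (unit, 'x, 'k) mor2 set" where
  "cat_trace n F = hom2 n one2 F"

definition scale2 :: "'k::field \<Rightarrow> ('x, 'y, 'k) mor2 \<Rightarrow> ('x, 'y, 'k) mor2" where
  "scale2 a \<eta> = (\<lambda>i j v. vscale a (\<eta> i j v))"

interpretation ms: vector_space "scale2 :: 'k::field \<Rightarrow> ('x, 'y, 'k) mor2 \<Rightarrow> ('x, 'y, 'k) mor2"
  by unfold_locales (auto simp: scale2_def vscale_def fun_eq_iff algebra_simps)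

text \<open>
  The composite \<open>\<one> \<Rightarrow> \<rho>\<^sub>1 = \<rho>\<^bsub>g g'\<^esub> \<Rightarrow> \<rho>\<^sub>g \<circ> \<rho>\<^bsub>g'\<^esub> \<Rightarrow> \<rho>\<^sub>g \<circ> (\<one> \<circ> \<rho>\<^bsub>g'\<^esub>) \<Rightarrow> \<rho>\<^sub>g \<circ> (\<rho>\<^sub>h \<circ> \<rho>\<^bsub>g'\<^esub>)
  \<Rightarrow> \<rho>\<^sub>g \<circ> \<rho>\<^bsub>h g'\<^esub> \<Rightarrow> \<rho>\<^bsub>g h g'\<^esub>\<close>, where \<open>g'\<close> is the inverse of \<open>g\<close>.
\<close>

definition psi ::
    "('g, 'm) monoid_scheme \<Rightarrow> ('g, 'x, 'k::field) two_rep \<Rightarrow> 'g \<Rightarrow> 'g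
      \<Rightarrow> (unit, 'x, 'k) mor2 \<Rightarrow> (unit, 'x, 'k) mor2" where
  "psi G R g h \<xi> =
    (let n = rdim R; r = rmor R; \<phi>1 = runit R; \<phi> = rmult R; g' = inv\<^bsub>G\<^esub> g in
      \<phi> g (h \<otimes>\<^bsub>G\<^esub> g')
      \<cdot>\<^sub>2 lwhisker n (r g) (comp1 n (r h) (r g')) (\<phi> h g')
      \<cdot>\<^sub>2 lwhisker n (r g) (comp1 n one2 (r g')) (rwhisker n one2 (r g') \<xi>)
      \<cdot>\<^sub>2 lwhisker n (r g) (r g') (inv2 n (comp1 n one2 (r g')) (r g') (lunit2 n (r g')))
      \<cdot>\<^sub>2 inv2 n (comp1 n (r g) (r g')) (r (g \<otimes>\<^bsub>G\<^esub> g')) (\<phi> g g')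
      \<cdot>\<^sub>2 inv2 n (r \<one>\<^bsub>G\<^esub>) one2 \<phi>1)"

text \<open>Meaningful if \<open>g\<close> and \<open>h\<close> commute, so that \<open>psi G R g h\<close> is an endomorphism.\<close>

definition two_character ::
    "('g, 'm) monoid_scheme \<Rightarrow> ('g, 'x, 'k::field) two_rep \<Rightarrow> 'g \<Rightarrow> 'g \<Rightarrow> 'k" where
  "two_character G R g h = ms.trace_on (cat_trace (rdim R) (rmor R h)) (psi G R g h)"


section \<open>The 2-representation given by a permutation action and a 2-cocycle\<close>

text \<open>The component \<open>c\<^sub>i(g,h)\<close> is written \<open>c g h i\<close>.\<close>

definition two_cocycle ::
    "('g, 'm) monoid_scheme \<Rightarrow> nat \<Rightarrow> ('g \<Rightarrow> nat \<Rightarrow> nat) \<Rightarrow> ('g \<Rightarrow> 'g \<Rightarrow> nat \<Rightarrow> complex) \<Rightarrow> bool" where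
  "two_cocycle G n \<rho> c \<longleftrightarrow>
     (\<forall>g\<in>carrier G. \<forall>h\<in>carrier G. \<forall>i\<in>{1..n}. c g h i \<noteq> 0)
   \<and> (\<forall>g\<in>carrier G. \<forall>h\<in>carrier G. \<forall>l\<in>carrier G. \<forall>i\<in>{1..n}.
        c h l (inv' (\<rho> g) i) * c g (h \<otimes>\<^bsub>G\<^esub> l) i = c (g \<otimes>\<^bsub>G\<^esub> h) l i * c g h i)"

definition perm_mat2 :: "(nat \<Rightarrow> nat) \<Rightarrow> (unit, 'k::field) mat2" where
  "perm_mat2 p = (\<lambda>i j. if i = p j then UNIV else {0})"

text \<open>
  The summand of the entry \<open>(i, k)\<close> of \<open>\<rho>\<^sub>g \<circ> \<rho>\<^sub>h\<close> that can be nonzero is the one with index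
  \<open>j = \<rho>\<^sub>h(k)\<close>; it is \<open>\<complex> \<otimes> \<complex>\<close>, identified with \<open>\<complex>\<close> by evaluation at \<open>((), ())\<close>.
\<close>

definition perm_two_rep ::
    "('g, 'm) monoid_scheme \<Rightarrow> nat \<Rightarrow> ('g \<Rightarrow> nat \<Rightarrow> nat) \<Rightarrow> ('g \<Rightarrow> 'g \<Rightarrow> nat \<Rightarrow> complex)
      \<Rightarrow> ('g, unit, complex) two_rep" where
  "perm_two_rep G n \<rho> c =
     \<lparr> rdim = n,
       rmor = (\<lambda>g. perm_mat2 (\<rho> g)),
       runit = restrict2 n (perm_mat2 (\<rho> \<one>\<^bsub>G\<^esub>)) (\<lambda>i j v. vscale (c \<one>\<^bsub>G\<^esub> \<one>\<^bsub>G\<^esub> i) v),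
       rmult = (\<lambda>g h. restrict2 n (comp1 n (perm_mat2 (\<rho> g)) (perm_mat2 (\<rho> h)))
                  (\<lambda>i k s. vscale (c g h i) (\<lambda>u. s (\<rho> h k, (), ())))) \<rparr>"


section \<open>Consistency of the definitions\<close>

lemma (in vector_space) trace_on_eq:
  assumes B: "independent B" "finite B" "span B = V"
    and f: "\<And>v. v \<in> V \<Longrightarrow> f v \<in> V"
      "\<And>u v. u \<in> V \<Longrightarrow> v \<in> V \<Longrightarrow> f (u + v) = f u + f v"
      "\<And>a v. v \<in> V \<Longrightarrow> f (scale a v) = scale a (f v)"
  shows "trace_on V f = (\<Sum>b\<in>B. representation B (f b) b)"
proof -
  define C where "C = (SOME C. independent C \<and> span C = V)"
  have "independent C \<and> span C = V"
    unfolding C_def by (rule someI[of _ B]) (use B in auto)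
  then have C: "independent C" "span C = V" by auto
  have finC: "finite C"
    using independent_span_bound[OF B(2) C(1)] B(3) C(2) span_superset[of C] by auto
  have inV: "b \<in> V" if "b \<in> B" for b using that B(3) span_base by blast
  have inV': "b \<in> V" if "b \<in> C" for b using that C(2) span_base by blast
  have f0: "f 0 = 0" using f(3)[of 0 0] span_zero[of B] B(3) by simp
  have fsum: "f (\<Sum>x\<in>X. scale (a x) (w x)) = (\<Sum>x\<in>X. scale (a x) (f (w x)))"
    if "finite X" "\<And>x. x \<in> X \<Longrightarrow> w x \<in> V" for X :: "'b set" and a w
    using that
  proof (induction X rule: finite_induct)
    case (insert x X)
    then show ?case
      by (simp add: f(2,3) B(3)[symmetric] span_sum span_scale)
  qed (simp add: f0)
  have expand: "(\<Sum>x\<in>X. scale (representation X v x) x) = v"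
    if "independent X" "finite X" "span X = V" "v \<in> V" for X v
    using sum_representation_eq[of X v X] that by auto
  have repsum: "representation X (\<Sum>y\<in>Y. scale (a y) (w y)) b = (\<Sum>y\<in>Y. a y * representation X (w y) b)"
    if "independent X" "span X = V" "\<And>y. y \<in> Y \<Longrightarrow> w y \<in> V" for X Y :: "'b set" and a w b
  proof -
    have "representation X (scale (a y) (w y)) b = a y * representation X (w y) b" if "y \<in> Y" for y
      using representation_scale[OF \<open>independent X\<close>, of "w y" "a y"] \<open>y \<in> Y \<Longrightarrow> w y \<in> V\<close> \<open>span X = V\<close> that
      by simp
    moreover have "scale (a y) (w y) \<in> span X" if "y \<in> Y" for y
      using \<open>y \<in> Y \<Longrightarrow> w y \<in> V\<close> \<open>span X = V\<close> that span_scale by blast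
    ultimately show ?thesis
      using representation_sum[OF \<open>independent X\<close>, of Y "\<lambda>y. scale (a y) (w y)"] by simp
  qed
  let ?r = "representation B" and ?s = "representation C"
  have r: "?r (f b) b = (\<Sum>c\<in>C. ?s b c * ?r (f c) b)" if "b \<in> B" for b
  proof -
    have "f b = (\<Sum>c\<in>C. scale (?s b c) (f c))"
      using fsum[OF finC, of "\<lambda>c. c" "?s b"] expand[OF C(1) finC C(2) inV[OF that]] inV' by simp
    then show ?thesis using repsum[OF B(1,3), of C f "?s b"] f(1) inV' by simp
  qed
  have s: "?s (f c) c = (\<Sum>b\<in>B. ?r (f c) b * ?s b c)" if "c \<in> C" for c
  proof -
    have "f c = (\<Sum>b\<in>B. scale (?r (f c) b) b)"
      using expand[OF B(1,2,3) f(1)[OF inV'[OF that]]] by simp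
    then show ?thesis using repsum[OF C(1,2), of B "\<lambda>b. b" "?r (f c)"] inV by metis
  qed
  have "trace_on V f = (\<Sum>c\<in>C. ?s (f c) c)"
    by (simp add: trace_on_def C_def Let_def)
  also have "\<dots> = (\<Sum>b\<in>B. \<Sum>c\<in>C. ?r (f c) b * ?s b c)"
    by (subst sum.swap) (simp add: s)
  also have "\<dots> = (\<Sum>b\<in>B. ?r (f b) b)"
    by (simp add: r mult.commute)
  finally show ?thesis .
qed

lemma tensor_slice1:
  assumes V: "fs.subspace V" and t: "t \<in> tensor V W"
  shows "(\<lambda>x. t (x, y)) \<in> V"
  using t unfolding tensor_def
proof (induction rule: fs.span_induct_alt)
  case base
  then show ?case using fs.subspace_0[OF V] by (simp add: zero_fun_def)
next
  case (step a p q)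
  then obtain v w where "p = pure_tensor v w" "v \<in> V" by auto
  then have "(\<lambda>x. (vscale a p + q) (x, y)) = vscale (a * w y) v + (\<lambda>x. q (x, y))"
    by (auto simp: pure_tensor_def vscale_def)
  with step \<open>v \<in> V\<close> show ?case
    by (simp add: fs.subspace_add[OF V] fs.subspace_scale[OF V])
qed

lemma lin_mapsD:
  assumes "f \<in> lin_maps V W"
  shows "v \<in> V \<Longrightarrow> f v \<in> W" "u \<in> V \<Longrightarrow> v \<in> V \<Longrightarrow> f (u + v) = f u + f v"
    "v \<in> V \<Longrightarrow> f (vscale a v) = vscale a (f v)" "v \<notin> V \<Longrightarrow> f v = 0"
  using assms by (auto simp: lin_maps_def)

lemma tensor_map_pure:
  assumes f: "f \<in> lin_maps V V'" and g: "g \<in> lin_maps W W'" and v: "v \<in> V" and w: "w \<in> W"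
  shows "tensor_map f g (pure_tensor v w) = pure_tensor (f v) (g w)"
proof -
  have "(\<lambda>x. pure_tensor v w (x, y)) = vscale (w y) v" for y
    by (simp add: pure_tensor_def vscale_def mult.commute)
  then have "(\<lambda>y. f (\<lambda>x. pure_tensor v w (x, y)) x') = vscale (f v x') w" for x'
    by (simp add: lin_mapsD(3)[OF f v]) (simp add: vscale_def mult.commute)
  then show ?thesis
    by (simp add: tensor_map_def lin_mapsD(3)[OF g w]) (simp add: vscale_def pure_tensor_def)
qed

lemma tensor_map_slice:
  assumes V: "fs.subspace V" and W: "fs.subspace W" and f: "f \<in> lin_maps V V'"
    and t: "t \<in> tensor V W"
  shows "(\<lambda>y. f (\<lambda>x. t (x, y)) x') \<in> W"
proof -
  have "(\<lambda>y. f (\<lambda>x. t (x, y)) x') \<in> W \<and> (\<forall>y. (\<lambda>x. t (x, y)) \<in> V)"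
  using t unfolding tensor_def
proof (induction rule: fs.span_induct_alt)
  case base
  have "f (\<lambda>x. 0) = 0"
    using lin_mapsD(3)[OF f fs.subspace_0[OF V], of 0] by (simp add: vscale_def zero_fun_def)
  then show ?case using fs.subspace_0[OF W] fs.subspace_0[OF V] by (simp add: zero_fun_def)
next
  case (step a p q)
  then obtain v w where p: "p = pure_tensor v w" and v: "v \<in> V" and w: "w \<in> W" by auto
  have q: "(\<lambda>x. q (x, y)) \<in> V" for y
    using step by blast
  have *: "(\<lambda>x. (vscale a p + q) (x, y)) = vscale (a * w y) v + (\<lambda>x. q (x, y))" for y
    by (auto simp: p pure_tensor_def vscale_def)
  then have "(\<lambda>y. f (\<lambda>x. (vscale a p + q) (x, y)) x')
      = vscale (a * f v x') w + (\<lambda>y. f (\<lambda>x. q (x, y)) x')"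
    using q v by (simp add: lin_mapsD[OF f] fs.subspace_scale[OF V])
      (simp add: vscale_def fun_eq_iff)
  with step w q v show ?case
    by (simp add: * fs.subspace_add[OF W] fs.subspace_scale[OF W]
        fs.subspace_add[OF V] fs.subspace_scale[OF V] del: plus_fun_apply)
qed
  then show ?thesis by blast
qed

lemma tensor_map_linear:
  assumes V: "fs.subspace V" and W: "fs.subspace W"
    and f: "f \<in> lin_maps V V'" and g: "g \<in> lin_maps W W'"
    and s: "s \<in> tensor V W" and t: "t \<in> tensor V W"
  shows "tensor_map f g (s + t) = tensor_map f g s + tensor_map f g t"
    and "tensor_map f g (vscale a t) = vscale a (tensor_map f g t)"
proof -
  have 1: "(\<lambda>x. (s + t) (x, y)) = (\<lambda>x. s (x, y)) + (\<lambda>x. t (x, y))"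
    "(\<lambda>x. vscale a t (x, y)) = vscale a (\<lambda>x. t (x, y))" for y
    by (auto simp: vscale_def)
  have 2: "(\<lambda>y. (f (\<lambda>x. s (x, y)) + f (\<lambda>x. t (x, y))) x')
      = (\<lambda>y. f (\<lambda>x. s (x, y)) x') + (\<lambda>y. f (\<lambda>x. t (x, y)) x')"
    "(\<lambda>y. vscale a (f (\<lambda>x. t (x, y))) x') = vscale a (\<lambda>y. f (\<lambda>x. t (x, y)) x')" for x'
    by (auto simp: vscale_def)
  show "tensor_map f g (s + t) = tensor_map f g s + tensor_map f g t"
    unfolding tensor_map_def 1
    by (simp add: lin_mapsD(2)[OF f] lin_mapsD(2)[OF g] tensor_slice1[OF V s] tensor_slice1[OF V t]
        2 tensor_map_slice[OF V W f] s t del: plus_fun_apply) auto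
  show "tensor_map f g (vscale a t) = vscale a (tensor_map f g t)"
    unfolding tensor_map_def 1
    by (simp add: lin_mapsD(3)[OF f] lin_mapsD(3)[OF g] tensor_slice1[OF V t]
        2 tensor_map_slice[OF V W f] t) (auto simp: vscale_def)
qed

definition supp_space :: "'x set \<Rightarrow> ('x \<Rightarrow> 'k::field) set" where
  "supp_space S = {f. \<forall>x. x \<notin> S \<longrightarrow> f x = 0}"

lemma perm_mat2_supp: "perm_mat2 p i j = supp_space {u. i = p j}"
  by (auto simp: perm_mat2_def supp_space_def)

lemma one2_supp: "one2 i j = supp_space {u. i = j}"
  by (auto simp: one2_def supp_space_def)

lemma subspace_supp_space: "fs.subspace (supp_space S)"
  by (auto simp: fs.subspace_def supp_space_def vscale_def)

lemma sum_fun_apply: "sum f A x = (\<Sum>a\<in>A. f a x)" for f :: "'a \<Rightarrow> 'b \<Rightarrow> 'c::comm_monoid_add"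
  by (induction A rule: infinite_finite_induct) auto

lemma tensor_supp_space:
  fixes S :: "'x set" and T :: "'y set"
  assumes "finite S" "finite T"
  shows "tensor (supp_space S) (supp_space T) = (supp_space (S \<times> T) :: ('x \<times> 'y \<Rightarrow> 'k::field) set)"
proof
  show "tensor (supp_space S) (supp_space T) \<subseteq> (supp_space (S \<times> T) :: ('x \<times> 'y \<Rightarrow> 'k) set)"
    unfolding tensor_def
    by (rule fs.span_minimal[OF _ subspace_supp_space]) (auto simp: supp_space_def pure_tensor_def)
  show "(supp_space (S \<times> T) :: ('x \<times> 'y \<Rightarrow> 'k) set) \<subseteq> tensor (supp_space S) (supp_space T)"
  proof
    fix f :: "'x \<times> 'y \<Rightarrow> 'k" assume f: "f \<in> supp_space (S \<times> T)"
    let ?d = "\<lambda>(a, b). pure_tensor (\<lambda>x. if x = a then 1 else 0) (\<lambda>y. if y = b then 1 else 0)"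
    have "f = (\<Sum>q\<in>S \<times> T. vscale (f q) (?d q))"
    proof
      fix q
      have "(\<Sum>q'\<in>S \<times> T. vscale (f q') (?d q')) q = (\<Sum>q'\<in>S \<times> T. if q' = q then f q' else 0)"
        by (auto simp: sum_fun_apply vscale_def pure_tensor_def intro!: sum.cong split: prod.splits)
      also have "\<dots> = f q"
        using assms f by (cases q) (auto simp: supp_space_def)
      finally show "f q = (\<Sum>q\<in>S \<times> T. vscale (f q) (?d q)) q" by simp
    qed
    moreover have "vscale (f q) (?d q) \<in> tensor (supp_space S) (supp_space T)" if "q \<in> S \<times> T" for q
      unfolding tensor_def using that
      by (cases q, simp only: prod.case, intro fs.span_scale fs.span_base CollectI exI conjI refl)
        (auto simp: supp_space_def)
    ultimately show "f \<in> tensor (supp_space S) (supp_space T)"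
      unfolding tensor_def by (metis (no_types, lifting) fs.span_sum)
  qed
qed

lemma comp1_supp_space:
  assumes "\<And>i j. A i j = supp_space (S i j)" "\<And>i j. B i j = supp_space (T i j)"
    and "\<And>i j. finite (S i j)" "\<And>i j. finite (T i j)"
  shows "comp1 n A B i k = supp_space {(j, x, y). j \<in> {1..n} \<and> x \<in> S i j \<and> y \<in> T j k}"
  unfolding comp1_def dsum_def assms(1,2) tensor_supp_space[OF assms(3,4)]
  by (auto simp: supp_space_def) (metis atLeastAtMost_iff)+

lemma comp_perm:
  "comp1 n (perm_mat2 p) (perm_mat2 q) i k = supp_space {(j, x, y). j \<in> {1..n} \<and> i = p j \<and> j = q k}"
  by (subst comp1_supp_space[OF perm_mat2_supp perm_mat2_supp]) (auto intro!: arg_cong[where f=supp_space] split: if_splits)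

lemma comp_one_perm:
  "comp1 n one2 (perm_mat2 q) i k = supp_space {(j, x, y). j \<in> {1..n} \<and> i = j \<and> j = q k}"
  by (subst comp1_supp_space[OF one2_supp perm_mat2_supp]) (auto intro!: arg_cong[where f=supp_space] split: if_splits)

lemma comp_perm_one:
  "comp1 n (perm_mat2 p) one2 i k = supp_space {(j, x, y). j \<in> {1..n} \<and> i = p j \<and> j = k}"
  by (subst comp1_supp_space[OF perm_mat2_supp one2_supp]) (auto intro!: arg_cong[where f=supp_space] split: if_splits)

lemma finite_idx: "finite {(j, ab :: unit \<times> unit). Suc 0 \<le> j \<and> j \<le> n \<and> P j}"
  by (rule finite_subset[of _ "{1..n} \<times> UNIV"]) auto

lemma comp_perm_perm_left:
  "comp1 n (comp1 n (perm_mat2 p) (perm_mat2 q)) (perm_mat2 r) i l =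
     supp_space {(k, (j, x, y), z). k \<in> {1..n} \<and> j \<in> {1..n} \<and> i = p j \<and> j = q k \<and> k = r l}"
  by (subst comp1_supp_space[OF comp_perm perm_mat2_supp]) (auto intro!: arg_cong[where f=supp_space] finite_idx split: if_splits)

lemma comp_perm_perm_right:
  "comp1 n (perm_mat2 p) (comp1 n (perm_mat2 q) (perm_mat2 r)) i l =
     supp_space {(j, x, (k, y, z)). j \<in> {1..n} \<and> k \<in> {1..n} \<and> i = p j \<and> j = q k \<and> k = r l}"
  by (subst comp1_supp_space[OF perm_mat2_supp comp_perm]) (auto intro!: arg_cong[where f=supp_space] finite_idx split: if_splits)

lemma id2_perm:
  "id2 n (perm_mat2 p) i j v = (if i \<in> {1..n} \<and> j \<in> {1..n} \<and> i = p j then v else 0)"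
  by (auto simp: id2_def restrict2_def perm_mat2_def)

lemma rwhisker_perm:
  "rwhisker n A (perm_mat2 q) \<eta> i k s (j, x, y) =
     (if i \<in> {1..n} \<and> k \<in> {1..n} \<and> s \<in> comp1 n A (perm_mat2 q) i k \<and> j \<in> {1..n} \<and> j = q k
      then \<eta> i j (\<lambda>x. s (j, x, y)) x else 0)"
  by (simp add: rwhisker_def hcomp_def restrict2_def[of _ "comp1 n A (perm_mat2 q)"] tensor_map_def
      id2_perm)

lemma lwhisker_perm:
  assumes "\<And>j k. \<theta> j k 0 = 0"
  shows "lwhisker n (perm_mat2 p) B \<theta> i k s (j, x, y) =
     (if i \<in> {1..n} \<and> k \<in> {1..n} \<and> s \<in> comp1 n (perm_mat2 p) B i k \<and> j \<in> {1..n} \<and> i = p j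
      then \<theta> j k (\<lambda>y. s (j, x, y)) y else 0)"
  using assms[of j k]
  by (cases "j \<in> {1..n} \<and> i = p j") (auto simp: zero_fun_def lwhisker_def hcomp_def restrict2_def[of _ "comp1 n (perm_mat2 p) B"] tensor_map_def
      id2_perm)

lemma two_representation_perm_two_rep:
  fixes G (structure)
  assumes "group G" and \<rho>: "\<rho> \<in> hom G (sym_group n)" and c: "two_cocycle G n \<rho> c"
  shows "two_representation G (perm_two_rep G n \<rho> c)"
proof -
  interpret group G by fact
  let ?P = "\<lambda>g. perm_mat2 (\<rho> g) :: (unit, complex) mat2"
  let ?u = "runit (perm_two_rep G n \<rho> c)" and ?m = "rmult (perm_two_rep G n \<rho> c)"
  have perm: "\<rho> g permutes {1..n}" if "g \<in> carrier G" for g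
    using hom_in_carrier[OF \<rho> that] by (simp add: sym_group_carrier)
  have mult: "\<rho> (g \<otimes> h) i = \<rho> g (\<rho> h i)" if "g \<in> carrier G" "h \<in> carrier G" for g h i
    using hom_mult[OF \<rho> that] by (simp add: sym_group_mult)
  have one: "\<rho> \<one> i = i" for i
    using mult[of \<one> \<one> i] permutes_inj[OF perm[of \<one>]] by (simp add: inj_eq)
  have rng: "\<rho> g i \<in> {1..n} \<longleftrightarrow> i \<in> {1..n}" if "g \<in> carrier G" for g i
    using permutes_in_image[OF perm[OF that]] .
  have rng': "Suc 0 \<le> \<rho> g i \<and> \<rho> g i \<le> n" if "g \<in> carrier G" "Suc 0 \<le> i" "i \<le> n" for g i
    using rng[of g i] that by auto
  have inv: "inv' (\<rho> g) (\<rho> g i) = i" if "g \<in> carrier G" for g i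
    using permutes_inverses(2)[OF perm[OF that]] .
  have c0: "c g h i \<noteq> 0" if "g \<in> carrier G" "h \<in> carrier G" "i \<in> {1..n}" for g h i
    using c that by (auto simp: two_cocycle_def)
  have coc: "c h l i * c g (h \<otimes> l) (\<rho> g i) = c (g \<otimes> h) l (\<rho> g i) * c g h (\<rho> g i)"
    if "g \<in> carrier G" "h \<in> carrier G" "l \<in> carrier G" "i \<in> {1..n}" for g h l i
    using c that rng[of g i] inv[of g i] unfolding two_cocycle_def by metis
  have c1: "c \<one> g i = c \<one> \<one> i" if "g \<in> carrier G" "i \<in> {1..n}" for g i
    using coc[of \<one> \<one> g i] c0[of \<one> g i] that by (simp add: one mult.commute)
  have c2: "c g \<one> (\<rho> g i) = c \<one> \<one> i" if "g \<in> carrier G" "i \<in> {1..n}" for g i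
    using coc[of g \<one> \<one> i] c0[of g \<one> "\<rho> g i"] that rng[of g i] by simp
  have mat: "is_mat2 n (?P g)" for g
    by (simp add: is_mat2_def perm_mat2_supp subspace_supp_space)
  have u: "?u \<in> iso2 n (?P \<one>) one2"
  proof -
    have "?u \<in> hom2 n (?P \<one>) one2"
      by (auto simp: perm_two_rep_def hom2_def lin_maps_def restrict2_def perm_mat2_supp one2_supp
          supp_space_def vscale_def one fun_eq_iff algebra_simps)
    moreover have "inverse2_of n (?P \<one>) one2 ?u (restrict2 n one2 (\<lambda>i j. vscale (inverse (c \<one> \<one> i))))"
      using c0[of \<one> \<one>]
      by (auto simp: perm_two_rep_def inverse2_of_def hom2_def lin_maps_def restrict2_def perm_mat2_supp
          one2_supp supp_space_def vscale_def one fun_eq_iff algebra_simps vcomp_def id2_def)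
    ultimately show ?thesis unfolding iso2_def by blast
  qed
  have m: "?m g h \<in> iso2 n (comp1 n (?P g) (?P h)) (?P (g \<otimes> h))"
    if g: "g \<in> carrier G" and h: "h \<in> carrier G" for g h
  proof -
    have "?m g h \<in> hom2 n (comp1 n (?P g) (?P h)) (?P (g \<otimes> h))"
      using g h
      by (auto simp: perm_two_rep_def hom2_def lin_maps_def restrict2_def perm_mat2_supp comp_perm
          supp_space_def vscale_def mult fun_eq_iff algebra_simps)
    moreover have "inverse2_of n (comp1 n (?P g) (?P h)) (?P (g \<otimes> h)) (?m g h)
       (restrict2 n (?P (g \<otimes> h)) (\<lambda>i k v. \<lambda>(j, x, y). if j = \<rho> h k then inverse (c g h i) * v () else 0))"
      using c0[OF g h] g h rng'[OF h]
      by (auto simp: perm_two_rep_def inverse2_of_def hom2_def lin_maps_def restrict2_def perm_mat2_supp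
          comp_perm supp_space_def vscale_def mult fun_eq_iff algebra_simps vcomp_def id2_def)
    ultimately show ?thesis unfolding iso2_def by blast
  qed
  have zero: "?u i j 0 = 0" "?m g h i j 0 = 0" for g h i j
    by (auto simp: perm_two_rep_def restrict2_def vscale_def)
  note lwm = lwhisker_perm[where \<theta> = "?m g h" for g h, OF zero(2)]
    and lwu = lwhisker_perm[where \<theta> = ?u, OF zero(1)]
  have m_eq: "?m g h i k s = (if i \<in> {1..n} \<and> k \<in> {1..n} \<and> s \<in> comp1 n (?P g) (?P h) i k
      then \<lambda>_. c g h i * s (\<rho> h k, (), ()) else 0)" for g h i k s
    by (auto simp: perm_two_rep_def restrict2_def vscale_def)
  have u_eq: "?u i k s = (if i \<in> {1..n} \<and> k \<in> {1..n} \<and> s \<in> ?P \<one> i k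
      then \<lambda>x. c \<one> \<one> i * s x else 0)" for i k s
    by (auto simp: perm_two_rep_def restrict2_def vscale_def)
  have a: "?m (g \<otimes> h) l \<cdot>\<^sub>2 rwhisker n (comp1 n (?P g) (?P h)) (?P l) (?m g h)
         = ?m g (h \<otimes> l) \<cdot>\<^sub>2 lwhisker n (?P g) (comp1 n (?P h) (?P l)) (?m h l)
             \<cdot>\<^sub>2 assoc2 n (?P g) (?P h) (?P l)" (is "?L = ?R")
    if g: "g \<in> carrier G" and h: "h \<in> carrier G" and l: "l \<in> carrier G" for g h l
  proof (intro ext)
    fix i k s and y :: unit
    let ?k = "\<rho> l k" and ?j = "\<rho> h (\<rho> l k)"
    let ?D = "comp1 n (comp1 n (?P g) (?P h)) (?P l) i k"
    show "?L i k s y = ?R i k s y"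
    proof (cases "i \<in> {1..n} \<and> k \<in> {1..n} \<and> s \<in> ?D")
      case False
      then have "rwhisker n (comp1 n (?P g) (?P h)) (?P l) (?m g h) i k s = 0"
        "assoc2 n (?P g) (?P h) (?P l) i k s = 0"
        by (auto simp: rwhisker_perm fun_eq_iff assoc2_def restrict2_def)
      moreover have "lwhisker n (?P g) (comp1 n (?P h) (?P l)) (?m h l) i k 0 = 0"
        using zero(2) by (auto simp: lwhisker_perm fun_eq_iff[of _ 0] simp flip: zero_fun_def)
      ultimately show ?thesis by (simp add: vcomp_def zero)
    next
      case True
      then have i: "i \<in> {1..n}" and k: "k \<in> {1..n}" and s: "s \<in> ?D" by auto
      have k': "?k \<in> {1..n}" and j: "?j \<in> {1..n}" using k rng l h by blast+
      have s0: "s (k', (j', x, y), z) = 0" if "\<not> (k' = ?k \<and> j' = ?j \<and> i = \<rho> g ?j)" for k' j' x y z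
        using s that unfolding comp_perm_perm_left supp_space_def by blast
      define t where "t = assoc2 n (?P g) (?P h) (?P l) i k s"
      have t: "t (j', x, (k', y, z)) = s (k', (j', x, y), z)" for j' x k' y z
        using i k s by (simp add: t_def assoc2_def restrict2_def)
      have tD: "t \<in> comp1 n (?P g) (comp1 n (?P h) (?P l)) i k"
        using s0 k' j unfolding comp_perm_perm_right supp_space_def by (auto simp: t) metis+
      have sl: "(\<lambda>x. s (?k, x, ())) \<in> comp1 n (?P g) (?P h) i ?k"
        using s0 k' j by (auto simp: comp_perm supp_space_def; metis s0)
      have tl: "(\<lambda>w. t (?j, (), w)) \<in> comp1 n (?P h) (?P l) ?j k"
        using s0 k' j by (auto simp: comp_perm supp_space_def t; metis s0)
      have R: "rwhisker n (comp1 n (?P g) (?P h)) (?P l) (?m g h) i k s \<in> comp1 n (?P (g \<otimes> h)) (?P l) i k"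
        using s0 k' by (auto simp: comp_perm supp_space_def rwhisker_perm m_eq mult[OF g h]; metis s0)
      have L: "lwhisker n (?P g) (comp1 n (?P h) (?P l)) (?m h l) i k t \<in> comp1 n (?P g) (?P (h \<otimes> l)) i k"
        using s0 k' j
        by (auto simp: comp_perm supp_space_def lwm m_eq mult[OF h l] t; metis s0)
      have "?L i k s y = c (g \<otimes> h) l i * (c g h i * s (?k, (?j, (), ()), ()))"
        using R i k k' s sl by (simp add: vcomp_def m_eq rwhisker_perm)
      moreover have "?R i k s y = c g (h \<otimes> l) i * (if i = \<rho> g ?j then c h l ?j * s (?k, (?j, (), ()), ()) else 0)"
        using L i k j tD tl
        by (simp add: vcomp_def m_eq lwm mult[OF h l] t t_def[symmetric])
      moreover have "c h l ?j * c g (h \<otimes> l) i = c (g \<otimes> h) l i * c g h i" if "i = \<rho> g ?j"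
        using coc[OF g h l j] that by simp
      ultimately show ?thesis using s0[of ?k ?j "()" "()" "()"] by (auto simp: algebra_simps)
    qed
  qed
  have b: "?m \<one> g = lunit2 n (?P g) \<cdot>\<^sub>2 rwhisker n (?P \<one>) (?P g) ?u"
    if g: "g \<in> carrier G" for g
  proof (intro ext)
    fix i k s and y :: unit
    let ?w = "rwhisker n (?P \<one>) (?P g) ?u i k s"
    show "?m \<one> g i k s y = (lunit2 n (?P g) \<cdot>\<^sub>2 rwhisker n (?P \<one>) (?P g) ?u) i k s y"
    proof (cases "i \<in> {1..n} \<and> k \<in> {1..n} \<and> s \<in> comp1 n (?P \<one>) (?P g) i k")
      case False
      then have "?w = 0" by (auto simp: rwhisker_perm fun_eq_iff)
      with False show ?thesis by (auto simp: vcomp_def m_eq lunit2_def restrict2_def)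
    next
      case True
      then have s0: "s (j', x, z) = 0" if "\<not> (j' = \<rho> g k \<and> i = j')" for j' x z
        using that unfolding comp_perm supp_space_def one by blast
      have w: "?w \<in> comp1 n one2 (?P g) i k"
        using s0 True by (auto simp: comp_one_perm supp_space_def rwhisker_perm u_eq)
      have "(\<lambda>x. s (i, x, ())) \<in> ?P \<one> i i"
        by (simp add: perm_mat2_def one)
      then show ?thesis
        using True w s0[of "\<rho> g k" "()" "()"] c1[OF g, of i]
        by (auto simp: vcomp_def m_eq lunit2_def restrict2_def rwhisker_perm u_eq)
    qed
  qed
  have d: "?m g \<one> = runit2 n (?P g) \<cdot>\<^sub>2 lwhisker n (?P g) (?P \<one>) ?u"
    if g: "g \<in> carrier G" for g
  proof (intro ext)
    fix i k s and y :: unit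
    let ?w = "lwhisker n (?P g) (?P \<one>) ?u i k s"
    show "?m g \<one> i k s y = (runit2 n (?P g) \<cdot>\<^sub>2 lwhisker n (?P g) (?P \<one>) ?u) i k s y"
    proof (cases "i \<in> {1..n} \<and> k \<in> {1..n} \<and> s \<in> comp1 n (?P g) (?P \<one>) i k")
      case False
      then have "?w = 0" by (auto simp: lwu fun_eq_iff)
      with False show ?thesis by (auto simp: vcomp_def m_eq runit2_def restrict2_def)
    next
      case True
      then have s0: "s (j', x, z) = 0" if "\<not> (j' = k \<and> i = \<rho> g j')" for j' x z
        using that unfolding comp_perm supp_space_def one by blast
      have w: "?w \<in> comp1 n (?P g) one2 i k"
        using s0 True by (auto simp: comp_perm_one supp_space_def lwu u_eq)
      have "(\<lambda>x. s (k, (), x)) \<in> ?P \<one> k k"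
        by (simp add: perm_mat2_def one)
      then show ?thesis
        using True w s0[of k "()" "()"] c2[OF g, of k]
        by (auto simp: vcomp_def m_eq runit2_def restrict2_def lwu u_eq one)
    qed
  qed
  have "rdim (perm_two_rep G n \<rho> c) = n" "rmor (perm_two_rep G n \<rho> c) = ?P"
    by (simp_all add: perm_two_rep_def)
  then show ?thesis
    unfolding two_representation_def Let_def using mat u m a b d by simp
qed

end

theory Submission
  imports Defs
begin

text \<open>
  The categorical trace of \<open>\<rho>\<^sub>h\<close> has a basis indexed by the fixed points of \<open>\<rho>\<^sub>h\<close>. Following the
  diagonal entry \<open>i\<close> through the composite \<open>\<psi>\<^sub>g(h)\<close>, the middle index is forced to be \<open>\<rho>\<^sub>g\<^sup>-\<^sup>1(i)\<close>, so
  \<open>\<psi>\<^sub>g(h)\<close> permutes the basis by \<open>\<rho>\<^sub>g\<close> up to scalars, and only the common fixed points of \<open>\<rho>\<^sub>g\<close> and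
  \<open>\<rho>\<^sub>h\<close> contribute to the trace.
\<close>

section \<open>Inverses of 2-morphisms and composites with the identity\<close>

lemma inverse2_of_unique:
  assumes \<theta>: "inverse2_of n A B \<eta> \<theta>" and \<theta>': "inverse2_of n A B \<eta> \<theta>'"
  shows "\<theta> = \<theta>'"
proof (intro ext)
  fix i j v x
  have h: "\<theta> \<in> hom2 n B A" "\<theta>' \<in> hom2 n B A" and e: "\<theta> \<cdot>\<^sub>2 \<eta> = id2 n A" "\<eta> \<cdot>\<^sub>2 \<theta>' = id2 n B"
    using assms by (auto simp: inverse2_of_def)
  show "\<theta> i j v x = \<theta>' i j v x"
  proof (cases "i \<in> {1..n} \<and> j \<in> {1..n} \<and> v \<in> B i j")
    case True
    then have l: "\<theta>' i j \<in> lin_maps (B i j) (A i j)"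
      using h(2) unfolding hom2_def by (auto dest: spec[of _ i] split: if_splits)
    \<comment> \<open>The usual monoid argument: the triple composite is evaluated once with
      \<theta> as left inverse and once with \<theta>' as right inverse.\<close>
    have "\<theta> i j (\<eta> i j (\<theta>' i j v)) = \<theta>' i j v"
      using fun_cong[OF fun_cong[OF fun_cong[OF e(1)]], of i j "\<theta>' i j v"] True lin_mapsD(1)[OF l]
      by (simp add: vcomp_def id2_def restrict2_def)
    moreover have "\<eta> i j (\<theta>' i j v) = v"
      using fun_cong[OF fun_cong[OF fun_cong[OF e(2)]], of i j v] True
      by (simp add: vcomp_def id2_def restrict2_def)
    ultimately show ?thesis by simp
  next
    case False
    \<comment> \<open>Off the domain both inverses agree because elements of \<open>hom2\<close> are
      extended by zero.\<close>
    have "\<kappa> i j v = 0" if "\<kappa> \<in> hom2 n B A" for \<kappa>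
    proof (cases "i \<in> {1..n} \<and> j \<in> {1..n}")
      case True
      then have "\<kappa> i j \<in> lin_maps (B i j) (A i j)" using that by (simp add: hom2_def)
      then show ?thesis using True False lin_mapsD(4) by blast
    qed (use that in \<open>auto simp: hom2_def\<close>)
    with h show ?thesis by simp
  qed
qed

text \<open>Replaces the definite description in \<open>inv2\<close> by an explicit witness; all
  three inverses occurring in \<open>psi\<close> are computed this way.\<close>

lemma inv2_eqI: "inverse2_of n A B \<eta> \<theta> \<Longrightarrow> inv2 n A B \<eta> = \<theta>"
  unfolding inv2_def by (rule the_equality) (auto intro: inverse2_of_unique)

text \<open>Row \<open>i\<close> of \<open>one2\<close> is nonzero only in column \<open>i\<close>,
  so the inverse must put its argument into the summand with middle index \<open>i\<close>.\<close>

lemma inv2_lunit2_perm: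
  "inv2 n (comp1 n one2 (perm_mat2 p)) (perm_mat2 p) (lunit2 n (perm_mat2 p)) =
     restrict2 n (perm_mat2 p :: (unit, 'k::field) mat2) (\<lambda>i k v. \<lambda>(j, x, y). if j = i then v y else 0)"
  by (rule inv2_eqI)
    (auto simp: inverse2_of_def hom2_def lin_maps_def restrict2_def perm_mat2_supp
      comp_one_perm supp_space_def vscale_def fun_eq_iff vcomp_def id2_def lunit2_def)

text \<open>Needed to propagate a zero vector through the whiskered factors of \<open>psi\<close> at
  positions off the diagonal.\<close>

lemma lwhisker_perm_zero:
  assumes "\<And>j k. \<theta> j k 0 = 0"
  shows "lwhisker n (perm_mat2 p) B \<theta> i k 0 = 0"
  using assms by (auto simp: lwhisker_perm fun_eq_iff[of _ 0] simp flip: zero_fun_def)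

text \<open>Makes the support lemmas for composites of permutation 2-matrices available when one
  factor is the identity.\<close>

lemma one2_perm: "one2 = perm_mat2 (\<lambda>i. i)"
  by (simp add: one2_def perm_mat2_def)

section \<open>A basis of the categorical trace of a permutation 2-matrix\<close>

definition diag_unit2 :: "nat \<Rightarrow> (unit, unit, 'k::field) mor2" where
  "diag_unit2 a = (\<lambda>i j v. if i = a \<and> j = a then v else 0)"

lemma diag_unit2_eq_iff [simp]: "diag_unit2 a = (diag_unit2 b :: (unit, unit, 'k::field) mor2) \<longleftrightarrow> a = b"
proof
  assume "diag_unit2 a = (diag_unit2 b :: (unit, unit, 'k) mor2)"
  then have "diag_unit2 a a a (\<lambda>_. 1) () = (diag_unit2 b a a (\<lambda>_. 1) () :: 'k)" by simp
  then show "a = b" by (auto simp: diag_unit2_def split: if_splits)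
qed simp

lemma sum_diag_unit2:
  assumes "finite I"
  shows "(\<Sum>a\<in>I. scale2 (f a) (diag_unit2 a)) i j v =
    (if i = j \<and> i \<in> I then vscale (f i) v else 0)"
proof -
  have "(\<Sum>a\<in>I. scale2 (f a) (diag_unit2 a)) i j v =
      (\<Sum>a\<in>I. if a = i then if i = j then vscale (f i) v else 0 else 0)"
    by (intro ext) (auto simp: sum_fun_apply scale2_def diag_unit2_def vscale_def
        intro!: sum.cong sum.neutral)
  then show ?thesis using assms by simp
qed

text \<open>Evaluating a vanishing combination at position \<open>(a, a)\<close> on the constant
  function 1 reads off the coefficient of \<open>diag_unit2 a\<close>.\<close>

lemma independent_diag_unit2:
  assumes "finite I"
  shows "ms.independent (diag_unit2 ` I :: (unit, unit, 'k::field) mor2 set)"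
proof
  assume "ms.dependent (diag_unit2 ` I :: (unit, unit, 'k) mor2 set)"
  then obtain f :: "(unit, unit, 'k) mor2 \<Rightarrow> 'k" and a
    where a: "a \<in> I" "f (diag_unit2 a) \<noteq> 0"
      and "(\<Sum>a\<in>I. scale2 (f (diag_unit2 a)) (diag_unit2 a)) = 0"
    using assms by (auto simp: ms.dependent_finite sum.reindex inj_on_def)
  then have "(\<Sum>a\<in>I. scale2 (f (diag_unit2 a)) (diag_unit2 a)) a a (\<lambda>_. 1) () = 0"
    by simp
  with a show False
    by (simp add: sum_diag_unit2[OF assms, where f="\<lambda>a. f (diag_unit2 a)"] vscale_def)
qed

text \<open>Off the diagonal the source is zero, and at a diagonal position not fixed by
  \<open>p\<close> the target is zero. What remains are endomorphisms of a one-dimensional space,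
  each being multiplication by its value at 1.\<close>

lemma cat_trace_perm:
  fixes \<xi> :: "(unit, unit, 'k::field) mor2"
  shows "\<xi> \<in> cat_trace n (perm_mat2 p) \<longleftrightarrow>
    (\<forall>i j v. \<xi> i j v = (if i = j \<and> i \<in> {1..n} \<and> i = p i then vscale (\<xi> i i (\<lambda>_. 1) ()) v else 0))"
    (is "_ \<longleftrightarrow> ?R")
proof
  assume \<xi>: "\<xi> \<in> cat_trace n (perm_mat2 p)"
  show ?R
  proof (intro allI)
    fix i j and v :: "unit \<Rightarrow> 'k"
    show "\<xi> i j v = (if i = j \<and> i \<in> {1..n} \<and> i = p i then vscale (\<xi> i i (\<lambda>_. 1) ()) v else 0)"
    proof (cases "i \<in> {1..n} \<and> j \<in> {1..n}")
      case True
      then have l: "\<xi> i j \<in> lin_maps (one2 i j) (perm_mat2 p i j)"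
        using \<xi> by (simp add: cat_trace_def hom2_def)
      have "v = vscale (v ()) (\<lambda>_. 1)" by (auto simp: vscale_def)
      then have "i = j \<Longrightarrow> \<xi> i j v = vscale (v ()) (\<xi> i j (\<lambda>_. 1))"
        using lin_mapsD(3)[OF l, of "\<lambda>_. 1" "v ()"] by (simp add: one2_def)
      moreover have "i \<noteq> j \<Longrightarrow> \<xi> i j v = 0"
        using lin_mapsD(4)[OF l, of v] lin_mapsD(3)[OF l, of 0 0]
        by (cases "v = 0") (simp_all add: one2_def zero_fun_def vscale_def)
      moreover have "i \<noteq> p j \<Longrightarrow> i = j \<Longrightarrow> \<xi> i j v = 0"
        using lin_mapsD(1)[OF l, of v] by (auto simp: one2_def perm_mat2_def)
      ultimately show ?thesis
        using True by (cases "i = j"; cases "i = p j") (simp_all add: vscale_def mult.commute)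
    qed (use \<xi> in \<open>auto simp: cat_trace_def hom2_def\<close>)
  qed
next
  assume R: ?R
  \<comment> \<open>Naming the scalars removes \<xi> from the right-hand side, so that it can be
    replaced by an explicit matrix.\<close>
  define f where "f i = \<xi> i i (\<lambda>_. 1) ()" for i
  have "\<xi> = (\<lambda>i j v. if i = j \<and> i \<in> {1..n} \<and> i = p i then vscale (f i) v else 0)"
    unfolding f_def by (rule ext, rule ext, rule ext) (rule R[rule_format])
  then show "\<xi> \<in> cat_trace n (perm_mat2 p)"
    unfolding cat_trace_def hom2_def lin_maps_def
    by (auto simp: one2_def perm_mat2_def vscale_def fun_eq_iff algebra_simps split: if_splits)
qed

lemma subspace_cat_trace_perm:
  "ms.subspace (cat_trace n (perm_mat2 p :: (unit, 'k::field) mat2))" (is "ms.subspace ?V")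
proof (rule ms.subspaceI)
  show "0 \<in> ?V" by (auto simp: cat_trace_perm vscale_def)
  fix \<xi> assume \<xi>: "\<xi> \<in> ?V"
  note \<xi>' = \<xi>[unfolded cat_trace_perm, rule_format]
  show "scale2 a \<xi> \<in> ?V" for a
    unfolding cat_trace_perm
  proof (intro allI)
    fix i j and v :: "unit \<Rightarrow> 'k"
    show "scale2 a \<xi> i j v =
        (if i = j \<and> i \<in> {1..n} \<and> i = p i then vscale (scale2 a \<xi> i i (\<lambda>_. 1) ()) v else 0)"
      using \<xi>'[of i j v] by (auto simp: scale2_def vscale_def)
  qed
  fix \<zeta> assume "\<zeta> \<in> ?V"
  note \<zeta>' = this[unfolded cat_trace_perm, rule_format]
  show "\<xi> + \<zeta> \<in> ?V"
    unfolding cat_trace_perm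
  proof (intro allI)
    fix i j and v :: "unit \<Rightarrow> 'k"
    show "(\<xi> + \<zeta>) i j v =
        (if i = j \<and> i \<in> {1..n} \<and> i = p i then vscale ((\<xi> + \<zeta>) i i (\<lambda>_. 1) ()) v else 0)"
      using \<xi>'[of i j v] \<zeta>'[of i j v] by (auto simp: vscale_def algebra_simps)
  qed
qed

lemma span_diag_unit2:
  "ms.span (diag_unit2 ` {i \<in> {1..n}. i = p i}) = cat_trace n (perm_mat2 p :: (unit, 'k::field) mat2)"
    (is "ms.span (_ ` ?I) = ?V")
proof
  have "diag_unit2 ` ?I \<subseteq> ?V"
    by (auto simp: cat_trace_perm diag_unit2_def vscale_def zero_fun_def)
  then show "ms.span (diag_unit2 ` ?I) \<subseteq> ?V"
    by (rule ms.span_minimal) (rule subspace_cat_trace_perm)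
  show "?V \<subseteq> ms.span (diag_unit2 ` ?I)"
  proof
    fix \<xi> assume \<xi>: "\<xi> \<in> ?V"
    have "\<xi> = (\<Sum>a\<in>?I. scale2 (\<xi> a a (\<lambda>_. 1) ()) (diag_unit2 a))"
      by (intro ext, subst \<xi>[unfolded cat_trace_perm, rule_format]) (simp add: sum_diag_unit2)
    also have "\<dots> \<in> ms.span (diag_unit2 ` ?I)"
      by (intro ms.span_sum ms.span_scale ms.span_base) auto
    finally show "\<xi> \<in> ms.span (diag_unit2 ` ?I)" .
  qed
qed

section \<open>The map \<open>psi\<close> for a permutation action and a 2-cocycle\<close>

locale perm_cocycle = group G for G (structure) +
  fixes n :: nat and \<rho> :: "'a \<Rightarrow> nat \<Rightarrow> nat" and c :: "'a \<Rightarrow> 'a \<Rightarrow> nat \<Rightarrow> complex"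
  assumes hom: "\<rho> \<in> hom G (sym_group n)"
    and cocycle: "two_cocycle G n \<rho> c"
begin

abbreviation P :: "'a \<Rightarrow> (unit, complex) mat2" where
  "P g \<equiv> perm_mat2 (\<rho> g)"

abbreviation \<phi>1 :: "(unit, unit, complex) mor2" where
  "\<phi>1 \<equiv> runit (perm_two_rep G n \<rho> c)"

abbreviation \<phi> :: "'a \<Rightarrow> 'a \<Rightarrow> (nat \<times> unit \<times> unit, unit, complex) mor2" where
  "\<phi> \<equiv> rmult (perm_two_rep G n \<rho> c)"

lemma permutes: "g \<in> carrier G \<Longrightarrow> \<rho> g permutes {1..n}"
  using hom_in_carrier[OF hom] by (simp add: sym_group_carrier)

lemma \<rho>_mult: "g \<in> carrier G \<Longrightarrow> h \<in> carrier G \<Longrightarrow> \<rho> (g \<otimes> h) i = \<rho> g (\<rho> h i)"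
  using hom_mult[OF hom] by (simp add: sym_group_mult)

lemma \<rho>_one [simp]: "\<rho> \<one> i = i"
  using \<rho>_mult[of \<one> \<one> i] permutes_inj[OF permutes[of \<one>]] by (simp add: inj_eq)

lemma \<rho>_in_iff: "g \<in> carrier G \<Longrightarrow> \<rho> g i \<in> {1..n} \<longleftrightarrow> i \<in> {1..n}"
  using permutes_in_image[OF permutes] .

lemma \<rho>_inv [simp]:
  assumes "g \<in> carrier G" shows "\<rho> (inv g) (\<rho> g i) = i" "\<rho> g (\<rho> (inv g) i) = i"
  using \<rho>_mult[of "inv g" g i] \<rho>_mult[of g "inv g" i] assms by auto

lemma eq_\<rho>_iff: "g \<in> carrier G \<Longrightarrow> i = \<rho> g j \<longleftrightarrow> j = \<rho> (inv g) i"
  by (metis \<rho>_inv)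

lemma c_nonzero: "g \<in> carrier G \<Longrightarrow> h \<in> carrier G \<Longrightarrow> i \<in> {1..n} \<Longrightarrow> c g h i \<noteq> 0"
  using cocycle by (auto simp: two_cocycle_def)

lemma \<phi>_eq:
  "\<phi> g h i k s = (if i \<in> {1..n} \<and> k \<in> {1..n} \<and> s \<in> comp1 n (P g) (P h) i k
     then \<lambda>_. c g h i * s (\<rho> h k, (), ()) else 0)"
  by (auto simp: perm_two_rep_def restrict2_def vscale_def)

lemma \<phi>_zero [simp]: "\<phi> g h i k 0 = 0"
  by (auto simp: \<phi>_eq)

lemma inv2_\<phi>1: "inv2 n (P \<one>) one2 \<phi>1 = restrict2 n one2 (\<lambda>i j. vscale (inverse (c \<one> \<one> i)))"
  by (rule inv2_eqI) (use c_nonzero[of \<one> \<one>] in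
    \<open>auto simp: perm_two_rep_def inverse2_of_def hom2_def lin_maps_def restrict2_def perm_mat2_supp
      one2_supp supp_space_def vscale_def fun_eq_iff algebra_simps vcomp_def id2_def\<close>)

lemma inv2_\<phi>:
  assumes g: "g \<in> carrier G" and h: "h \<in> carrier G"
  shows "inv2 n (comp1 n (P g) (P h)) (P (g \<otimes> h)) (\<phi> g h) =
    restrict2 n (P (g \<otimes> h)) (\<lambda>i k v. \<lambda>(j, x, y). if j = \<rho> h k then inverse (c g h i) * v () else 0)"
proof (rule inv2_eqI)
  \<comment> \<open>The middle index \<open>\<rho> h k\<close> of the only possibly nonzero summand
    stays in range; the inequalities have the form that simplification of interval membership
    produces.\<close>
  have "Suc 0 \<le> \<rho> h i \<and> \<rho> h i \<le> n" if "Suc 0 \<le> i" "i \<le> n" for i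
    using \<rho>_in_iff[OF h, of i] that by auto
  then show "inverse2_of n (comp1 n (P g) (P h)) (P (g \<otimes> h)) (\<phi> g h)
    (restrict2 n (P (g \<otimes> h)) (\<lambda>i k v. \<lambda>(j, x, y). if j = \<rho> h k then inverse (c g h i) * v () else 0))"
    using c_nonzero[OF g h]
    by (auto simp: perm_two_rep_def inverse2_of_def hom2_def lin_maps_def restrict2_def perm_mat2_supp
        comp_perm supp_space_def vscale_def \<rho>_mult[OF g h] fun_eq_iff algebra_simps vcomp_def id2_def)
qed

text \<open>The scalar by which \<open>\<psi>\<^sub>g(h)\<close> acts from position \<open>\<rho>\<^sub>g\<^sup>-\<^sup>1(i)\<close> to position \<open>i\<close>.\<close>

definition coeff :: "'a \<Rightarrow> 'a \<Rightarrow> nat \<Rightarrow> complex" where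
  "coeff g h i = inverse (c g (inv g) i) * inverse (c \<one> \<one> i)
     * c h (inv g) (\<rho> (inv g) i) * c g (h \<otimes> inv g) i"

text \<open>A vector is pushed through the six factors of \<open>psi\<close> from right to left. On
  the diagonal each intermediate vector has at most one nonzero coordinate, and every factor
  multiplies its value by one scalar.\<close>

lemma psi_eq:
  assumes g: "g \<in> carrier G" and h: "h \<in> carrier G" and \<xi>: "\<xi> \<in> cat_trace n (P h)"
  shows "psi G (perm_two_rep G n \<rho> c) g h \<xi> i k v =
    (if i = k \<and> i \<in> {1..n}
     then vscale (coeff g h i * \<xi> (\<rho> (inv g) i) (\<rho> (inv g) i) (\<lambda>_. 1) ()) v else 0)"
proof -
  let ?g = "inv g"
  have g': "?g \<in> carrier G" and gg: "g \<otimes> ?g = \<one>" using g by auto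
  have \<xi>_eq: "\<xi> i j v = (if i = j \<and> i \<in> {1..n} \<and> i = \<rho> h i then vscale (\<xi> i i (\<lambda>_. 1) ()) v else 0)" for i j v
    using \<xi> unfolding cat_trace_perm by blast
  have \<xi>0: "\<xi> i j 0 = 0" for i j by (subst \<xi>_eq) (auto simp: vscale_def)
  define L where "L = restrict2 n (P ?g) (\<lambda>i k v. \<lambda>(j, x::unit, y). if j = i then v y else 0)"
  define X where "X = rwhisker n one2 (P ?g) \<xi>"
  have L0: "L i k 0 = 0" for i k by (auto simp: L_def restrict2_def)
  have L_eq: "L i k v (j, x, y) = (if i \<in> {1..n} \<and> k \<in> {1..n} \<and> v \<in> P ?g i k \<and> j = i then v y else 0)"
    for i k v j x y by (simp add: L_def restrict2_def)
  have X_eq: "X i k s (j, x, y) = (if i \<in> {1..n} \<and> k \<in> {1..n} \<and> s \<in> comp1 n one2 (P ?g) i k \<and>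
      j \<in> {1..n} \<and> j = \<rho> ?g k then \<xi> i j (\<lambda>x. s (j, x, y)) x else 0)" for i k s j x y
    unfolding X_def by (rule rwhisker_perm)
  have X0: "X i k 0 = 0" for i k
    using \<xi>0 by (auto simp: X_def rwhisker_perm fun_eq_iff[of _ 0] simp flip: zero_fun_def)
  \<comment> \<open>The images of \<open>v\<close> after the inverse of \<open>\<phi>1\<close>, the
    inverse of \<open>\<phi> g (inv g)\<close>, the inverse unit isomorphism, the whiskered \<xi>
    and the whiskered \<open>\<phi> h (inv g)\<close>.\<close>
  define s1 where "s1 = restrict2 n one2 (\<lambda>i j. vscale (inverse (c \<one> \<one> i))) i k v"
  define s2 where "s2 = restrict2 n (P \<one>)
    (\<lambda>i k v. \<lambda>(j, x::unit, y::unit). if j = \<rho> ?g k then inverse (c g ?g i) * v () else 0) i k s1"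
  define s3 where "s3 = lwhisker n (P g) (P ?g) L i k s2"
  define s4 where "s4 = lwhisker n (P g) (comp1 n one2 (P ?g)) X i k s3"
  define s5 where "s5 = lwhisker n (P g) (comp1 n (P h) (P ?g)) (\<phi> h ?g) i k s4"
  have psi: "psi G (perm_two_rep G n \<rho> c) g h \<xi> i k v = \<phi> g (h \<otimes> ?g) i k s5"
    using inv2_\<phi>[OF g g'] inv2_\<phi>1
    by (simp add: psi_def Let_def vcomp_def s1_def s2_def s3_def s4_def s5_def X_def L_def
        inv2_lunit2_perm gg perm_two_rep_def)
  show ?thesis
  proof (cases "i = k \<and> i \<in> {1..n}")
    case False
    \<comment> \<open>The first factor already yields zero, since \<open>one2\<close> vanishes off
      the diagonal; all later factors preserve zero.\<close>
    then have "s1 = 0" by (auto simp: s1_def restrict2_def one2_def vscale_def)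
    then have "s2 = 0" by (auto simp: s2_def restrict2_def fun_eq_iff)
    then have "s3 = 0" by (simp add: s3_def lwhisker_perm_zero L0)
    then have "s4 = 0" by (simp add: s4_def lwhisker_perm_zero X0)
    then have "s5 = 0" by (simp add: s5_def lwhisker_perm_zero)
    then show ?thesis using False by (auto simp: psi)
  next
    case True
    then have k: "k = i" and i: "i \<in> {1..n}" by auto
    define j where "j = \<rho> ?g i"
    have j: "j \<in> {1..n}" and gi: "\<rho> ?g i = j" and rg: "i = \<rho> g a \<longleftrightarrow> a = j" for a
      using i g g' \<rho>_in_iff by (auto simp: j_def eq_\<rho>_iff[OF g] simp del: atLeastAtMost_iff)
    have P_ji: "P ?g j i = UNIV" by (simp add: perm_mat2_def gi)
    define w where "w = inverse (c g ?g i) * (inverse (c \<one> \<one> i) * v ())"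
    define z where "z = \<xi> j j (\<lambda>_. 1) ()"
    \<comment> \<open>This lets \<open>s4\<close> lie in the composite with \<open>P h\<close> in
      place of \<open>one2\<close>: its coordinate at \<open>j\<close> is allowed only if
      \<open>\<rho> h\<close> fixes \<open>j\<close>.\<close>
    have z: "z = 0" if "j \<noteq> \<rho> h j" using \<xi>_eq[of j j] that by (simp add: z_def)
    have \<xi>j: "\<xi> j j u () = z * u ()" for u
      using \<xi>_eq[of j j u] z j by (auto simp: z_def vscale_def)
    have s2: "s2 (a, x, y) = (if a = j then w else 0)" for a x y
      using i by (simp add: s2_def s1_def k restrict2_def perm_mat2_def one2_def vscale_def gi rg w_def)
    \<comment> \<open>Restricted 2-morphisms return zero outside their domain, so membership must be
      checked before the next factor is evaluated.\<close>
    have s2D: "s2 \<in> comp1 n (P g) (P ?g) i k"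
      using j by (auto simp: comp_perm supp_space_def s2 k gi rg split: if_splits)
    have s3: "s3 (a, x, (b, y, y')) = (if a = j \<and> b = j then w else 0)" for a x b y y'
      using i j s2D by (simp add: s3_def lwhisker_perm[where \<theta>=L, OF L0] k L_eq s2 gi rg P_ji)
    have s3D: "s3 \<in> comp1 n (P g) (comp1 n one2 (P ?g)) i k"
      using j by (auto simp: one2_perm comp_perm_perm_right supp_space_def s3 k gi rg split: if_splits)
    \<comment> \<open>Whiskering applies the inner 2-morphism to the slice at \<open>j\<close>,
      whose membership is a separate condition.\<close>
    have s3D': "(\<lambda>y. s3 (j, x, y)) \<in> comp1 n one2 (P ?g) j k" for x
      using j by (auto simp: comp_one_perm supp_space_def s3 k gi rg split: if_splits)
    have s4: "s4 (a, x, (b, y, y')) = (if a = j \<and> b = j then z * w else 0)" for a x b y y'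
      using i j s3D s3D'
      by (auto simp: s4_def lwhisker_perm[where \<theta>=X, OF X0] X_eq k s3 \<xi>j gi rg)
    have s4D: "s4 \<in> comp1 n (P g) (comp1 n (P h) (P ?g)) i k"
      using z j by (auto simp: comp_perm_perm_right supp_space_def s4 k gi rg split: if_splits)
    have s4D': "(\<lambda>y. s4 (j, x, y)) \<in> comp1 n (P h) (P ?g) j k" for x
      using z j by (auto simp: comp_perm supp_space_def s4 k gi rg split: if_splits)
    have s5: "s5 (a, x, y) = (if a = j then c h ?g j * (z * w) else 0)" for a x y
      using i j s4D s4D'
      by (auto simp: s5_def lwhisker_perm[where \<theta>="\<phi> h ?g", OF \<phi>_zero] k \<phi>_eq s4 gi rg)
    have s5D: "s5 \<in> comp1 n (P g) (P (h \<otimes> ?g)) i k"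
      using z j by (auto simp: comp_perm supp_space_def s5 k \<rho>_mult[OF h g'] gi rg split: if_splits)
    have "\<phi> g (h \<otimes> ?g) i k s5 = (\<lambda>_. c g (h \<otimes> ?g) i * (c h ?g j * (z * w)))"
      using z s5D i by (auto simp: \<phi>_eq k s5 \<rho>_mult[OF h g'] gi fun_eq_iff)
    then show ?thesis
      unfolding psi using i by (simp add: k vscale_def coeff_def gi z_def[symmetric] w_def fun_eq_iff)
  qed
qed

end

section \<open>The trace of \<open>psi\<close> in the fixed-point basis\<close>

theorem theorem1:
  fixes G :: "('g, 'm) monoid_scheme"
    and n :: nat
    and \<rho> :: "'g \<Rightarrow> nat \<Rightarrow> nat"
    and c :: "'g \<Rightarrow> 'g \<Rightarrow> nat \<Rightarrow> complex"
    and g h :: 'g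
  assumes "group G"
    and "\<rho> \<in> hom G (sym_group n)"
    and "two_cocycle G n \<rho> c"
    and "g \<in> carrier G" and "h \<in> carrier G"
    and "g \<otimes>\<^bsub>G\<^esub> h = h \<otimes>\<^bsub>G\<^esub> g"
  shows "two_character G (perm_two_rep G n \<rho> c) g h =
    (\<Sum>i\<in>{i\<in>{1..n}. i = \<rho> g i \<and> i = \<rho> h i}.
       inverse (c g (inv\<^bsub>G\<^esub> g) i) * inverse (c \<one>\<^bsub>G\<^esub> \<one>\<^bsub>G\<^esub> i)
         * c h (inv\<^bsub>G\<^esub> g) i * c g (h \<otimes>\<^bsub>G\<^esub> inv\<^bsub>G\<^esub> g) i)"
proof -
  interpret perm_cocycle G n \<rho> c
    using assms by (simp add: perm_cocycle_def perm_cocycle_axioms_def)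
  note g = assms(4) and h = assms(5)
  have comm: "\<rho> g (\<rho> h i) = \<rho> h (\<rho> g i)" for i
    using \<rho>_mult[OF g h, of i] \<rho>_mult[OF h g, of i] assms(6) by simp
  have inv_eq: "\<rho> (inv\<^bsub>G\<^esub> g) i = j \<longleftrightarrow> i = \<rho> g j" for i j
    using g by auto
  let ?I = "{i \<in> {1..n}. i = \<rho> h i}" and ?e = "diag_unit2 :: nat \<Rightarrow> (unit, unit, complex) mor2"
  let ?V = "cat_trace n (P h)" and ?\<psi> = "psi G (perm_two_rep G n \<rho> c) g h"
  let ?B = "?e ` ?I"
  \<comment> \<open>Commuting permutations preserve each other's fixed points; here commutation of
    \<open>g\<close> and \<open>h\<close> enters.\<close>
  have fixed: "\<rho> g i \<in> ?I" if "i \<in> ?I" for i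
    using that \<rho>_in_iff[OF g, of i] comm[of i] by auto
  have ind: "ms.independent ?B" by (rule independent_diag_unit2) simp
  have span: "ms.span ?B = ?V" by (rule span_diag_unit2)
  have \<psi>_unit: "?\<psi> (?e i) = scale2 (coeff g h (\<rho> g i)) (?e (\<rho> g i))" if "i \<in> ?I" for i
  proof -
    have "?e i \<in> ?V" unfolding span[symmetric] by (rule ms.span_base) (use that in blast)
    moreover have "\<rho> g i \<in> {1..n}" using fixed[OF that] by blast
    ultimately show ?thesis
      by (auto simp: fun_eq_iff psi_eq[OF g h] scale2_def diag_unit2_def vscale_def inv_eq)
  qed
  \<comment> \<open>The entry at \<open>i\<close> is a multiple of the entry of \<xi> at the
    preimage of \<open>i\<close> under \<open>\<rho> g\<close>; if \<open>\<rho> h\<close> moves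
    \<open>i\<close>, it moves this preimage too, and that entry vanishes.\<close>
  have mem: "?\<psi> \<xi> \<in> ?V" if \<xi>: "\<xi> \<in> ?V" for \<xi>
  proof -
    have "\<xi> (\<rho> (inv\<^bsub>G\<^esub> g) i) (\<rho> (inv\<^bsub>G\<^esub> g) i) (\<lambda>_. 1) () = 0" if "i \<noteq> \<rho> h i" for i
    proof -
      have "\<rho> (inv\<^bsub>G\<^esub> g) i \<noteq> \<rho> h (\<rho> (inv\<^bsub>G\<^esub> g) i)"
        using that comm[of "\<rho> (inv\<^bsub>G\<^esub> g) i"] g by (metis \<rho>_inv(2))
      then show ?thesis
        using \<xi>[unfolded cat_trace_perm, rule_format, of "\<rho> (inv\<^bsub>G\<^esub> g) i"
          "\<rho> (inv\<^bsub>G\<^esub> g) i" "\<lambda>_. 1"] by simp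
    qed
    then show ?thesis
      unfolding cat_trace_perm by (auto simp: psi_eq[OF g h \<xi>] vscale_def)
  qed
  have add: "?\<psi> (\<xi> + \<zeta>) = ?\<psi> \<xi> + ?\<psi> \<zeta>" if "\<xi> \<in> ?V" "\<zeta> \<in> ?V" for \<xi> \<zeta>
    using that ms.subspace_add[OF subspace_cat_trace_perm that]
    by (auto simp: fun_eq_iff psi_eq[OF g h] vscale_def algebra_simps)
  have scale: "?\<psi> (scale2 a \<xi>) = scale2 a (?\<psi> \<xi>)" if "\<xi> \<in> ?V" for \<xi> a
    using that ms.subspace_scale[OF subspace_cat_trace_perm that, of a]
    by (auto simp: fun_eq_iff psi_eq[OF g h] vscale_def scale2_def algebra_simps)
  have rep: "ms.representation ?B (?\<psi> (?e i)) (?e i) = (if i = \<rho> g i then coeff g h i else 0)"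
    if "i \<in> ?I" for i
    using fixed[OF that] ind
    by (auto simp: \<psi>_unit[OF that] ms.representation_scale ms.span_base ms.representation_basis)
  have "two_character G (perm_two_rep G n \<rho> c) g h = ms.trace_on ?V ?\<psi>"
    by (simp add: two_character_def perm_two_rep_def)
  \<comment> \<open>The trace is defined through an arbitrary basis; basis independence for a linear
    endomorphism permits the explicit one.\<close>
  also have "\<dots> = (\<Sum>b\<in>?B. ms.representation ?B (?\<psi> b) b)"
    by (rule ms.trace_on_eq[OF ind _ span]) (auto intro: mem add scale)
  also have "\<dots> = (\<Sum>i\<in>?I. if i = \<rho> g i then coeff g h i else 0)"
    by (rule sum.reindex_cong[where l="?e"])
      (simp_all only: rep inj_on_def diag_unit2_eq_iff simp_thms ball_simps)
  also have "\<dots> = (\<Sum>i\<in>{i\<in>{1..n}. i = \<rho> g i \<and> i = \<rho> h i}. coeff g h i)"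
    by (rule sum.mono_neutral_cong_right) auto
  also have "\<dots> = (\<Sum>i\<in>{i\<in>{1..n}. i = \<rho> g i \<and> i = \<rho> h i}.
       inverse (c g (inv\<^bsub>G\<^esub> g) i) * inverse (c \<one>\<^bsub>G\<^esub> \<one>\<^bsub>G\<^esub> i)
         * c h (inv\<^bsub>G\<^esub> g) i * c g (h \<otimes>\<^bsub>G\<^esub> inv\<^bsub>G\<^esub> g) i)"
  \<comment> \<open>At a fixed point of \<open>\<rho> g\<close> the shifted index in
    \<open>coeff\<close> is \<open>i\<close> itself.\<close>
  proof (rule sum.cong[OF refl])
    fix i assume "i \<in> {i\<in>{1..n}. i = \<rho> g i \<and> i = \<rho> h i}"
    then have "\<rho> (inv\<^bsub>G\<^esub> g) i = i" by (simp add: inv_eq)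
    then show "coeff g h i = inverse (c g (inv\<^bsub>G\<^esub> g) i) * inverse (c \<one>\<^bsub>G\<^esub> \<one>\<^bsub>G\<^esub> i)
         * c h (inv\<^bsub>G\<^esub> g) i * c g (h \<otimes>\<^bsub>G\<^esub> inv\<^bsub>G\<^esub> g) i"
      by (simp add: coeff_def)
  qed
  finally show ?thesis .
qed

end
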